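(* Let $m$ be a positive integer which is not of the form $2^l - 1$ with $l$ a natural number, and let $C = A \cap [0, m]$ and $D = B \cap [0, m]$. Then there exists a positive integer $n$ with $m < n < 2m$ such that $R_{C}(n) \ne R_{D}(n)$.
   Context: Natural numbers are nonnegative integers, $\mathbb{N} = \{0,1,2,\dots\}$, and $[a,b]$ denotes the set of integers $x$ with $a \le x \le b$. For a set $S$ of nonnegative integers, $R_S(n)$ denotes the number of solutions of $s + s' = n$ with $s, s' \in S$ and $s < s'$. $A$ is the set of those nonnegative integers whose binary representation contains an even number of digits $1$ (so $0 \in A$), and $B = \mathbb{N} \setminus A$. *)

theory Defs
  imports Main
begin

definition repr_count :: "nat set \<Rightarrow> nat \<Rightarrow> nat" where
  "repr_count S n = card {(s, s'). s \<in> S \<and> s' \<in> S \<and> s < s' \<and> s + s' = n}"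

(* "bit n k" says that the binary digit of n at the place 2^k is 1; for a natural
   number only finitely many k have this property, so the cardinality is the number of ones. *)
definition evil_numbers :: "nat set" where
  "evil_numbers = {n. even (card {k. bit n k})}"

definition odious_numbers :: "nat set" where
  "odious_numbers = - evil_numbers"

end

theory Submission
  imports Defs
begin

text \<open>
  Let \<open>t\<close> be the Thue--Morse sign, \<open>1\<close> on \<open>A\<close> and \<open>-1\<close> on \<open>B\<close>. Since the product of two indicators of
  \<open>A\<close> minus that of two indicators of \<open>B\<close> is half the sum of the two signs,
  \<open>2 (R\<^sub>C(n) - R\<^sub>D(n))\<close> is the sum of \<open>t i\<close> over \<open>n - m \<le> i \<le> m\<close>, \<open>2 i \<noteq> n\<close>. The partial sums of \<open>t\<close>
  vanish at even places and equal \<open>t j\<close> at \<open>2 j + 1\<close>. If all differences are \<open>0\<close> and \<open>m\<close> is even,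
  then \<open>t m = t j\<close> for all \<open>j < m / 2\<close>, which fails. If \<open>m = 2 M - 1\<close>, then
  \<open>t (j + M) = - t j\<close> for all \<open>j < M\<close>; this property passes from \<open>2 M\<close> to \<open>M\<close> and fails for odd
  \<open>M > 1\<close>, where it would give \<open>t (M + 1) = t (M + 2) = 1\<close> although \<open>M + 1\<close> is even. So \<open>M\<close> is a
  power of two.
\<close>

definition thue_morse :: "nat \<Rightarrow> int" where
  "thue_morse n = (if n \<in> evil_numbers then 1 else - 1)"

lemma finite_bits: "finite {k. bit (n::nat) k}"
proof (rule finite_subset)
  show "{k. bit n k} \<subseteq> {..<n}"
  proof
    fix k assume "k \<in> {k. bit n k}"
    then have "n div 2 ^ k \<noteq> 0" by (auto simp: bit_iff_odd intro: ccontr)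
    then have "2 ^ k \<le> n" by (metis div_less not_le)
    then show "k \<in> {..<n}" using less_le_trans[OF less_exp] by blast
  qed
qed simp

lemma bits_double: "{k. bit (2 * n :: nat) k} = Suc ` {k. bit n k}"
proof (rule set_eqI)
  fix k show "k \<in> {k. bit (2 * n) k} \<longleftrightarrow> k \<in> Suc ` {k. bit n k}"
    by (cases k) (auto simp: bit_0 bit_Suc)
qed

lemma bits_double_Suc: "{k. bit (Suc (2 * n)) k} = insert 0 (Suc ` {k. bit n k})"
proof (rule set_eqI)
  fix k show "k \<in> {k. bit (Suc (2 * n)) k} \<longleftrightarrow> k \<in> insert 0 (Suc ` {k. bit n k})"
    by (cases k) (auto simp: bit_0 bit_Suc)
qed

lemma thue_morse_0: "thue_morse 0 = 1"
  by (simp add: thue_morse_def evil_numbers_def bot_fun_def)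

lemma thue_morse_double: "thue_morse (2 * n) = thue_morse n"
  by (simp add: thue_morse_def evil_numbers_def bits_double card_image)

lemma thue_morse_double_Suc: "thue_morse (Suc (2 * n)) = - thue_morse n"
  by (simp add: thue_morse_def evil_numbers_def bits_double_Suc card_image finite_bits)

lemma thue_morse_1: "thue_morse (Suc 0) = - 1"
  using thue_morse_double_Suc[of 0] by (simp add: thue_morse_0)

lemma thue_morse_2: "thue_morse 2 = - 1"
  using thue_morse_double[of 1] by (simp add: thue_morse_1)

text \<open>The terms at \<open>2 * i\<close> and \<open>Suc (2 * i)\<close> cancel.\<close>

lemma sum_thue_morse_even: "(\<Sum>i<2 * n. thue_morse i) = 0"
  by (induction n) (simp_all add: thue_morse_double thue_morse_double_Suc)

lemma sum_thue_morse_odd: "(\<Sum>i<Suc (2 * n). thue_morse i) = thue_morse n"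
  by (simp add: sum_thue_morse_even thue_morse_double)

text \<open>A representation is determined by its smaller summand \<open>i\<close>; the bound
  \<open>n - m \<le> i\<close> expresses that the larger one, \<open>n - i\<close>, is at most
  \<open>m\<close>.\<close>

lemma repr_count_eq_sum:
  assumes "m < n" "n < 2 * m"
  shows "int (repr_count (S \<inter> {0..m}) n) =
    (\<Sum>i\<in>{i. n - m \<le> i \<and> 2 * i < n}. of_bool (i \<in> S \<and> n - i \<in> S))"
proof -
  let ?L = "{i. n - m \<le> i \<and> 2 * i < n}"
  have fin: "finite ?L" by (rule finite_subset[of _ "{..n}"]) auto
  have "bij_betw (\<lambda>i. (i, n - i)) {i\<in>?L. i \<in> S \<and> n - i \<in> S}
    {(s, s'). s \<in> S \<inter> {0..m} \<and> s' \<in> S \<inter> {0..m} \<and> s < s' \<and> s + s' = n}"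
    by (rule bij_betw_byWitness[where f' = fst]) (use assms in auto)
  then have "repr_count (S \<inter> {0..m}) n = card {i\<in>?L. i \<in> S \<and> n - i \<in> S}"
    unfolding repr_count_def by (rule bij_betw_same_card[symmetric])
  also have "int \<dots> = (\<Sum>i\<in>?L. of_bool (i \<in> S \<and> n - i \<in> S))"
    using fin by (simp add: sum_of_bool_eq Int_def)
  finally show ?thesis .
qed

lemma repr_count_diff:
  assumes "m < n" "n < 2 * m"
  shows "2 * (int (repr_count (evil_numbers \<inter> {0..m}) n)
        - int (repr_count (odious_numbers \<inter> {0..m}) n))
    = (\<Sum>i\<in>{n - m..m} - {i. 2 * i = n}. thue_morse i)"
proof -
  let ?L = "{i. n - m \<le> i \<and> 2 * i < n}"
  let ?U = "{i. i \<le> m \<and> n < 2 * i}"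
  have "2 * (int (repr_count (evil_numbers \<inter> {0..m}) n)
        - int (repr_count (odious_numbers \<inter> {0..m}) n))
    = (\<Sum>i\<in>?L. thue_morse i + thue_morse (n - i))"
    unfolding repr_count_eq_sum[OF assms] sum_subtractf[symmetric] sum_distrib_left
    by (rule sum.cong) (auto simp: thue_morse_def odious_numbers_def)
  also have "\<dots> = (\<Sum>i\<in>?L. thue_morse i) + (\<Sum>i\<in>?L. thue_morse (n - i))"
    by (rule sum.distrib)
  \<comment> \<open>Reflection in \<open>n / 2\<close> carries the smaller summands to the larger
    ones.\<close>
  also have "(\<Sum>i\<in>?L. thue_morse (n - i)) = (\<Sum>i\<in>?U. thue_morse i)"
    by (rule sum.reindex_bij_witness[of _ "\<lambda>i. n - i" "\<lambda>i. n - i"]) (use assms in auto)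
  also have "(\<Sum>i\<in>?L. thue_morse i) + (\<Sum>i\<in>?U. thue_morse i)
      = (\<Sum>i\<in>?L \<union> ?U. thue_morse i)"
    by (rule sum.union_disjoint[symmetric])
      (auto intro: finite_subset[of _ "{..n}"] finite_subset[of _ "{..m}"])
  also have "?L \<union> ?U = {n - m..m} - {i. 2 * i = n}" using assms by auto
  finally show ?thesis .
qed

lemma sum_atLeastAtMost_eq_diff:
  fixes f :: "nat \<Rightarrow> int"
  assumes "k \<le> Suc m"
  shows "(\<Sum>i=k..m. f i) = (\<Sum>i<Suc m. f i) - (\<Sum>i<k. f i)"
proof -
  have "{..<Suc m} = {..<k} \<union> {k..m}" using assms by auto
  moreover have "sum f ({..<k} \<union> {k..m}) = sum f {..<k} + sum f {k..m}"
    by (rule sum.union_disjoint) auto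
  ultimately show ?thesis by simp
qed

lemma antiperiodic_thue_morse_imp_power_of_2:
  assumes "M > 0" "\<And>j. j < M \<Longrightarrow> thue_morse (j + M) = - thue_morse j"
  shows "\<exists>l. M = 2 ^ l"
  using assms
proof (induction M rule: less_induct)
  case (less M)
  show ?case
  proof (cases "even M")
    case True
    then obtain N where N: "M = 2 * N" by (elim evenE)
    \<comment> \<open>Restrict the hypothesis to even places, where doubling preserves the
      sign.\<close>
    have "thue_morse (j + N) = - thue_morse j" if "j < N" for j
      using less.prems(2)[of "2 * j"] that thue_morse_double[of "j + N"]
      by (simp add: N thue_morse_double)
    then obtain l where "N = 2 ^ l" using less.IH[of N] less.prems(1) N by auto
    then have "M = 2 ^ Suc l" by (simp add: N)
    then show ?thesis ..
  next
    case False
    then obtain N where N: "M = Suc (2 * N)" by (metis oddE Suc_eq_plus1)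
    show ?thesis
    proof (cases "N = 0")
      case True
      then have "M = 2 ^ 0" by (simp add: N)
      then show ?thesis ..
    next
      case False
      \<comment> \<open>Both left sides are determined by \<open>thue_morse (Suc N)\<close>: the
        first forces it to be -1, the second 1. The place 2 is below \<open>M\<close> since
        \<open>N \<noteq> 0\<close>.\<close>
      have "thue_morse (Suc (2 * Suc N)) = - thue_morse 2"
           "thue_morse (2 * Suc N) = - thue_morse 1"
        using less.prems(2)[of 2] less.prems(2)[of 1] N False by simp_all
      then have False
        unfolding thue_morse_double thue_morse_double_Suc
        by (simp add: thue_morse_1 thue_morse_2)
      then show ?thesis ..
    qed
  qed
qed

theorem corollary1:
  fixes m :: nat and C D :: "nat set"
  assumes "m > 0"
    and "\<not> (\<exists>l::nat. m = 2 ^ l - 1)"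
    and "C = evil_numbers \<inter> {0..m}"
    and "D = odious_numbers \<inter> {0..m}"
  shows "\<exists>n::nat. n > 0 \<and> m < n \<and> n < 2 * m \<and> repr_count C n \<noteq> repr_count D n"
proof (rule ccontr)
  assume "\<not> ?thesis"
  then have eq: "repr_count C n = repr_count D n" if "m < n" "n < 2 * m" for n
    using that by auto
  have zero: "(\<Sum>i\<in>{k..m} - {i. 2 * i = k + m}. thue_morse i) = 0" if "0 < k" "k < m" for k
    using repr_count_diff[of m "k + m"] eq[of "k + m"] that assms(3,4) by simp
  show False
  proof (cases "even m")
    case True
    then obtain M where M: "m = 2 * M" by (elim evenE)
    \<comment> \<open>Take \<open>k = 2 * j + 1\<close>: then \<open>k + m\<close> is odd, so no
      middle term is removed.\<close>
    have const: "thue_morse m = thue_morse j" if "j < M" for j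
    proof -
      have "{i. 2 * i = Suc (2 * j) + m} = {}" unfolding M by (auto, presburger)
      then have "(\<Sum>i=Suc (2 * j)..m. thue_morse i) = 0"
        using zero[of "Suc (2 * j)"] that M by simp
      then show ?thesis
        using that M sum_thue_morse_odd[of M] sum_thue_morse_odd[of j]
        by (simp add: sum_atLeastAtMost_eq_diff thue_morse_double)
    qed
    have "M > 0" using assms(1) M by simp
    then consider "M = 1" | "1 < M" by linarith
    then show False
    proof cases
      case 1
      then show False using const[of 0] M by (simp add: thue_morse_0 thue_morse_2)
    next
      case 2
      then show False using const[of 0] const[of 1] by (simp add: thue_morse_0 thue_morse_1)
    qed
  next
    case False
    then obtain N where N: "m = Suc (2 * N)" by (metis oddE Suc_eq_plus1)
    have "thue_morse (j + Suc N) = - thue_morse j" if "j < Suc N" for j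
    proof (cases "j = N")
      case True
      \<comment> \<open>Here \<open>k = 2 * j + 1\<close> would equal \<open>m\<close>, outside the
        range of \<open>zero\<close>, but \<open>j + Suc N = 2 * N + 1\<close>.\<close>
      then show ?thesis using thue_morse_double_Suc[of N] by (simp add: mult_2)
    next
      case False
      \<comment> \<open>Now \<open>k + m\<close> is even, and its half is the one index left
        out.\<close>
      have set: "{i. 2 * i = Suc (2 * j) + m} = {j + Suc N}" unfolding N by auto
      have mem: "j + Suc N \<in> {Suc (2 * j)..m}" using that False N by auto
      have "(\<Sum>i\<in>{Suc (2 * j)..m} - {j + Suc N}. thue_morse i) = 0"
        using zero[of "Suc (2 * j)"] that False N set by simp
      then have "(\<Sum>i=Suc (2 * j)..m. thue_morse i) = thue_morse (j + Suc N)"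
        using sum.remove[OF _ mem, of thue_morse] by simp
      \<comment> \<open>The sum over \<open>0..m\<close> has \<open>2 * Suc N\<close> terms and
        vanishes.\<close>
      moreover have "(\<Sum>i=Suc (2 * j)..m. thue_morse i) = - thue_morse j"
        using that N sum_atLeastAtMost_eq_diff[of "Suc (2 * j)" m thue_morse]
          sum_thue_morse_even[of "Suc N"] sum_thue_morse_odd[of j] by simp
      ultimately show ?thesis by simp
    qed
    then obtain l where "Suc N = 2 ^ l"
      using antiperiodic_thue_morse_imp_power_of_2[of "Suc N"] by blast
    then have "m = 2 ^ Suc l - 1" using N by simp
    then show False using assms(2) by blast
  qed
qed

end
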